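(* Let $T>0$, let $\mathrm{w}\neq 0$ be a real number, and let $\nu_1,\nu_2,\nu_3$ be nonnegative integers. Let $\mathcal{N}=\mathcal{K}^{\nu_3}\,\mathcal{CR}\,\mathcal{K}^{\nu_1}$ be the new two-grid waveform relaxation operator defined in the context, considered as an operator in $C[0,T]=C([0,T];\mathbb{C}^{N})$. Then $\mathcal{N}$ is a bounded operator in $C[0,T]$ and its spectral radius is $$\rho(\mathcal{N})=\rho\Big((M_{B_h}^{-1}N_{B_h})^{\nu_3}\,(I-pB_H^{-1}rB_h)\,\Big(I+\mathrm{w}\,(M_{B_h}^{-1}N_{B_h})^{\nu_2}\Big(I-\Big(1+\frac{1}{\mathrm{w}^2}\Big)pB_H^{-1}rB_h\Big)\Big)\,(M_{B_h}^{-1}N_{B_h})^{\nu_1}\Big),$$ where the right-hand side is the spectral radius of an $N\times N$ matrix.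
   Context: Setting. $\Omega\subset\mathbb{R}^2$ is a bounded domain, triangulated by an admissible mesh $\Omega_h$ (two different elements meet in the empty set, a vertex, or a whole edge), and $V_h$ is the space of continuous piecewise linear functions on $\Omega_h$ vanishing on $\partial\Omega$, with nodal basis $\phi_1,\dots,\phi_N$. The mass matrix is $B_h=\big(\int_\Omega\phi_i\phi_j\,d\mathbf{x}\big)\in\mathbb{R}^{N\times N}$ and the stiffness matrix is $A_h=\big(\int_\Omega\nabla\phi_i\cdot\nabla\phi_j\,d\mathbf{x}\big)\in\mathbb{R}^{N\times N}$. They arise from the semi-discretization $B_h\dot{\mathbf u}_h+A_h\mathbf u_h=F_h$, $\mathbf u_h(0)=g_h$, of the heat equation with homogeneous Dirichlet conditions. The matrices $B_H,A_H\in\mathbb{R}^{N_H\times N_H}$ are the mass and stiffness matrices obtained in the same way on the coarse mesh $\Omega_H$, $H=2h$, with $\Omega_{2h}\subset\Omega_h$. The matrix $p\in\mathbb{R}^{N\times N_H}$ is the prolongation (linear interpolation), and $r\in\mathbb{R}^{N_H\times N}$ is the restriction, the adjoint of $p$ up to a fixed positive scaling factor. Splittings: $B_h=M_{B_h}-N_{B_h}$ and $A_h=M_{A_h}-N_{A_h}$, with $M_{B_h}$ invertible. (For example, in the Gauss-Seidel splitting $M_{B_h},M_{A_h}$ are the lower triangular parts including the diagonal, and $-N_{B_h},-N_{A_h}$ are the strictly upper triangular parts.) Convolution: for a matrix-valued kernel $k$, $(k\star u)(t)=\int_0^t k(t-s)u(s)\,ds$. An operator $u\mapsto k\star u$ is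 said to be of linear Volterra convolution type. Standard waveform relaxation operator: $$\mathcal{K}u(t)=M_{B_h}^{-1}N_{B_h}u(t)+(k_c\star u)(t),\qquad k_c(t)=e^{-M_{B_h}^{-1}M_{A_h}t}M_{B_h}^{-1}\big(N_{A_h}-M_{A_h}M_{B_h}^{-1}N_{B_h}\big).$$ Correction kernels: $$C_{2c}(t)=p\,e^{-B_H^{-1}A_Ht}B_H^{-1}\big(A_HB_H^{-1}rB_h-rA_h\big),\qquad C_{1c}(t)=\Big(1+\frac1{\mathrm{w}^2}\Big)C_{2c}(t).$$ New two-grid correction waveform operator: $$\mathcal{CR}\,u=(I-pB_H^{-1}rB_h)\Big(I+\mathrm{w}\,\mathcal{K}^{\nu_2}\Big(I-\Big(1+\frac1{\mathrm{w}^2}\Big)pB_H^{-1}rB_h\Big)\Big)u+\mathcal{CR}_c u,$$ $$\mathcal{CR}_c u=C_{2c}\star\Big(\Big(I+\mathrm{w}\,\mathcal{K}^{\nu_2}\Big(I-\Big(1+\frac1{\mathrm{w}^2}\Big)pB_H^{-1}rB_h\Big)\Big)u\Big)+\mathrm{w}\,(I-pB_H^{-1}rB_h)\,\mathcal{K}^{\nu_2}(C_{1c}\star u)+\mathrm{w}\,C_{2c}\star\big(\mathcal{K}^{\nu_2}(C_{1c}\star u)\big).$$ New two-grid waveform relaxation operator: $\mathcal{N}u=\mathcal{K}^{\nu_3}\,\mathcal{CR}\,\mathcal{K}^{\nu_1}u$. $\rho(\cdot)$ denotes the spectral radius of a bounded operator or of a matrix. *)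

theory Defs
  imports "HOL-Analysis.Analysis"
begin

section \<open>Piecewise linear finite elements on a triangulated planar domain\<close>

definition admissible_mesh :: "(real^2) set \<Rightarrow> (real^2) set set \<Rightarrow> bool" where
  "admissible_mesh \<Omega> \<T> \<longleftrightarrow>
     finite \<T> \<and> (\<forall>E\<in>\<T>. 2 simplex E) \<and> \<Union>\<T> = closure \<Omega> \<and>
     (\<forall>E\<in>\<T>. \<forall>E'\<in>\<T>. E \<noteq> E' \<longrightarrow>
        E \<inter> E' = {} \<or>
        (\<exists>z. E \<inter> E' = {z} \<and> z extreme_point_of E \<and> z extreme_point_of E') \<or>
        ((E \<inter> E') edge_of E \<and> (E \<inter> E') edge_of E'))"

definition mesh_vertices :: "(real^2) set set \<Rightarrow> (real^2) set" where
  "mesh_vertices \<T> = {z. \<exists>E\<in>\<T>. z extreme_point_of E}"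

definition mesh_size :: "(real^2) set set \<Rightarrow> real" where
  "mesh_size \<T> = Max (diameter ` \<T>)"

text \<open>The functions of the space live on the closure of the domain; they are represented by
  their extension by zero, so that equality in the space is equality of functions.\<close>

definition fe_space :: "(real^2) set \<Rightarrow> (real^2) set set \<Rightarrow> (real^2 \<Rightarrow> real) set" where
  "fe_space \<Omega> \<T> = {v. continuous_on (closure \<Omega>) v \<and>
     (\<forall>E\<in>\<T>. \<exists>a b. \<forall>x\<in>E. v x = a \<bullet> x + b) \<and>
     (\<forall>x\<in>frontier \<Omega>. v x = 0) \<and> (\<forall>x. x \<notin> closure \<Omega> \<longrightarrow> v x = 0)}"

text \<open>The finite index type enumerates the mesh vertices lying in the open domain, that is, the
  degrees of freedom left by the homogeneous Dirichlet condition.\<close>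

definition nodal_basis ::
    "(real^2) set \<Rightarrow> (real^2) set set \<Rightarrow> ('n::finite \<Rightarrow> real^2) \<Rightarrow> ('n \<Rightarrow> real^2 \<Rightarrow> real) \<Rightarrow> bool" where
  "nodal_basis \<Omega> \<T> \<xi> \<phi> \<longleftrightarrow>
     bij_betw \<xi> UNIV (mesh_vertices \<T> \<inter> \<Omega>) \<and>
     (\<forall>i. \<phi> i \<in> fe_space \<Omega> \<T> \<and> (\<forall>j. \<phi> i (\<xi> j) = (if i = j then 1 else 0)))"

definition mass_matrix ::
    "(real^2) set \<Rightarrow> ('n::finite \<Rightarrow> real^2 \<Rightarrow> real) \<Rightarrow> real^'n^'n" where
  "mass_matrix \<Omega> \<phi> = (\<chi> i j. set_lebesgue_integral lebesgue \<Omega> (\<lambda>x. \<phi> i x * \<phi> j x))"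

text \<open>Finite element functions are differentiable off the edges of the mesh. The arbitrary value
  of the gradient on this null set is harmless, since the integrals below are taken with respect
  to the completed measure.\<close>

definition grad :: "(real^2 \<Rightarrow> real) \<Rightarrow> real^2 \<Rightarrow> real^2" where
  "grad v x = (THE D. GDERIV v x :> D)"

definition stiffness_matrix ::
    "(real^2) set \<Rightarrow> ('n::finite \<Rightarrow> real^2 \<Rightarrow> real) \<Rightarrow> real^'n^'n" where
  "stiffness_matrix \<Omega> \<phi> =
     (\<chi> i j. set_lebesgue_integral lebesgue \<Omega> (\<lambda>x. grad (\<phi> i) x \<bullet> grad (\<phi> j) x))"

text \<open>Linear interpolation: the coarse function with nodal values \<open>c\<close> is evaluated at the
  fine nodes \<open>\<xi> i\<close>, so that \<open>(p c)\<^sub>i = (\<Sum>j. c\<^sub>j * \<Phi> j (\<xi> i))\<close>.\<close>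

definition prolongation ::
    "('n::finite \<Rightarrow> real^2) \<Rightarrow> ('m::finite \<Rightarrow> real^2 \<Rightarrow> real) \<Rightarrow> real^'m^'n" where
  "prolongation \<xi> \<Phi> = (\<chi> i j. \<Phi> j (\<xi> i))"


section \<open>Matrix powers, the matrix exponential and the spectral radius of a matrix\<close>

text \<open>The type class power and exponential are not applicable here, because \<open>*\<close> on vectors and
  matrices is componentwise.\<close>

primrec matpow :: "'a::semiring_1^'n^'n \<Rightarrow> nat \<Rightarrow> 'a^'n^'n" where
  "matpow A 0 = mat 1"
| "matpow A (Suc k) = A ** matpow A k"

definition matexp :: "real^'n^'n \<Rightarrow> real^'n^'n" where
  "matexp A = (\<Sum>k. (1 / fact k) *\<^sub>R matpow A k)"

abbreviation complex_matrix :: "real^'m^'n \<Rightarrow> complex^'m^'n" where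
  "complex_matrix \<equiv> map_matrix complex_of_real"

definition matrix_spectrum :: "complex^'n^'n \<Rightarrow> complex set" where
  "matrix_spectrum A = {\<mu>. \<exists>v. v \<noteq> 0 \<and> A *v v = \<mu> *s v}"

definition matrix_spectral_radius :: "complex^'n^'n \<Rightarrow> real" where
  "matrix_spectral_radius A = (SUP \<mu>\<in>matrix_spectrum A. norm \<mu>)"


section \<open>Bounded operators on \<open>C[0,T]\<close>\<close>

text \<open>A continuous function on \<open>[0,T]\<close> is represented by its extension by zero to the real
  line (which need not be continuous at the end points).\<close>

definition C_space :: "real \<Rightarrow> (real \<Rightarrow> complex^'n) set" where
  "C_space T = {u. continuous_on {0..T} u \<and> (\<forall>t. t \<notin> {0..T} \<longrightarrow> u t = 0)}"

definition sup_norm :: "real \<Rightarrow> (real \<Rightarrow> complex^'n) \<Rightarrow> real" where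
  "sup_norm T u = (SUP t\<in>{0..T}. norm (u t))"

definition bounded_operator ::
    "real \<Rightarrow> ((real \<Rightarrow> complex^'n) \<Rightarrow> (real \<Rightarrow> complex^'n)) \<Rightarrow> bool" where
  "bounded_operator T L \<longleftrightarrow>
     (\<forall>u\<in>C_space T. L u \<in> C_space T) \<and>
     (\<forall>u\<in>C_space T. \<forall>v\<in>C_space T. L (\<lambda>t. u t + v t) = (\<lambda>t. L u t + L v t)) \<and>
     (\<forall>c. \<forall>u\<in>C_space T. L (\<lambda>t. c *s u t) = (\<lambda>t. c *s L u t)) \<and>
     (\<exists>K. \<forall>u\<in>C_space T. sup_norm T (L u) \<le> K * sup_norm T u)"

definition op_shift ::
    "((real \<Rightarrow> complex^'n) \<Rightarrow> (real \<Rightarrow> complex^'n)) \<Rightarrow> complex \<Rightarrow>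
      (real \<Rightarrow> complex^'n) \<Rightarrow> (real \<Rightarrow> complex^'n)" where
  "op_shift L \<mu> u = (\<lambda>t. \<mu> *s u t - L u t)"

definition op_spectrum ::
    "real \<Rightarrow> ((real \<Rightarrow> complex^'n) \<Rightarrow> (real \<Rightarrow> complex^'n)) \<Rightarrow> complex set" where
  "op_spectrum T L = {\<mu>. \<not> (\<exists>R. bounded_operator T R \<and>
     (\<forall>u\<in>C_space T. R (op_shift L \<mu> u) = u \<and> op_shift L \<mu> (R u) = u))}"

definition op_spectral_radius ::
    "real \<Rightarrow> ((real \<Rightarrow> complex^'n) \<Rightarrow> (real \<Rightarrow> complex^'n)) \<Rightarrow> real" where
  "op_spectral_radius T L = (SUP \<mu>\<in>op_spectrum T L. norm \<mu>)"


section \<open>Waveform relaxation operators\<close>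

definition matrix_op :: "real^'n^'n \<Rightarrow> (real \<Rightarrow> complex^'n) \<Rightarrow> (real \<Rightarrow> complex^'n)" where
  "matrix_op A u = (\<lambda>t. complex_matrix A *v u t)"

text \<open>Off \<open>[0,T]\<close> the convolution is set to zero, to stay within the representation of
  \<open>C[0,T]\<close>; on \<open>[0,T]\<close> its value does not depend on \<open>T\<close>.\<close>

definition conv ::
    "real \<Rightarrow> (real \<Rightarrow> real^'n^'n) \<Rightarrow> (real \<Rightarrow> complex^'n) \<Rightarrow> (real \<Rightarrow> complex^'n)" where
  "conv T k u = (\<lambda>t. if t \<in> {0..T}
     then integral {0..t} (\<lambda>s. complex_matrix (k (t - s)) *v u s) else 0)"

definition wr_kernel ::
    "real^'n^'n \<Rightarrow> real^'n^'n \<Rightarrow> real^'n^'n \<Rightarrow> real^'n^'n \<Rightarrow> real \<Rightarrow> real^'n^'n" where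
  "wr_kernel MB NB MA NA t =
     matexp ((- t) *\<^sub>R (matrix_inv MB ** MA)) ** matrix_inv MB **
       (NA - MA ** matrix_inv MB ** NB)"

definition wr_op ::
    "real \<Rightarrow> real^'n^'n \<Rightarrow> real^'n^'n \<Rightarrow> real^'n^'n \<Rightarrow> real^'n^'n \<Rightarrow>
      (real \<Rightarrow> complex^'n) \<Rightarrow> (real \<Rightarrow> complex^'n)" where
  "wr_op T MB NB MA NA u =
     (\<lambda>t. matrix_op (matrix_inv MB ** NB) u t + conv T (wr_kernel MB NB MA NA) u t)"

definition C2c ::
    "real^'n^'n \<Rightarrow> real^'n^'n \<Rightarrow> real^'m^'m \<Rightarrow> real^'m^'m \<Rightarrow> real^'m^'n \<Rightarrow> real^'n^'m \<Rightarrow>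
      real \<Rightarrow> real^'n^'n" where
  "C2c Bh Ah BH AH p r t =
     p ** matexp ((- t) *\<^sub>R (matrix_inv BH ** AH)) ** matrix_inv BH **
       (AH ** matrix_inv BH ** r ** Bh - r ** Ah)"

definition C1c ::
    "real \<Rightarrow> real^'n^'n \<Rightarrow> real^'n^'n \<Rightarrow> real^'m^'m \<Rightarrow> real^'m^'m \<Rightarrow> real^'m^'n \<Rightarrow> real^'n^'m \<Rightarrow>
      real \<Rightarrow> real^'n^'n" where
  "C1c w Bh Ah BH AH p r t = (1 + 1 / w\<^sup>2) *\<^sub>R C2c Bh Ah BH AH p r t"

definition coarse_mat ::
    "real^'n^'n \<Rightarrow> real^'m^'m \<Rightarrow> real^'m^'n \<Rightarrow> real^'n^'m \<Rightarrow> real^'n^'n" where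
  "coarse_mat Bh BH p r = p ** matrix_inv BH ** r ** Bh"

text \<open>In the following, \<open>Kn\<close> stands for the operator \<open>K\<^sup>\<nu>\<close> of the intermediate smoothing.\<close>

definition CR_inner ::
    "real \<Rightarrow> real^'n^'n \<Rightarrow> real^'m^'m \<Rightarrow> real^'m^'n \<Rightarrow> real^'n^'m \<Rightarrow>
      ((real \<Rightarrow> complex^'n) \<Rightarrow> (real \<Rightarrow> complex^'n)) \<Rightarrow>
      (real \<Rightarrow> complex^'n) \<Rightarrow> (real \<Rightarrow> complex^'n)" where
  "CR_inner w Bh BH p r Kn u =
     (\<lambda>t. u t + w *\<^sub>R Kn (matrix_op (mat 1 - (1 + 1 / w\<^sup>2) *\<^sub>R coarse_mat Bh BH p r) u) t)"

definition CR_c ::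
    "real \<Rightarrow> real \<Rightarrow> real^'n^'n \<Rightarrow> real^'n^'n \<Rightarrow> real^'m^'m \<Rightarrow> real^'m^'m \<Rightarrow>
      real^'m^'n \<Rightarrow> real^'n^'m \<Rightarrow> ((real \<Rightarrow> complex^'n) \<Rightarrow> (real \<Rightarrow> complex^'n)) \<Rightarrow>
      (real \<Rightarrow> complex^'n) \<Rightarrow> (real \<Rightarrow> complex^'n)" where
  "CR_c T w Bh Ah BH AH p r Kn u =
     (\<lambda>t. conv T (C2c Bh Ah BH AH p r) (CR_inner w Bh BH p r Kn u) t
        + w *\<^sub>R matrix_op (mat 1 - coarse_mat Bh BH p r)
            (Kn (conv T (C1c w Bh Ah BH AH p r) u)) t
        + w *\<^sub>R conv T (C2c Bh Ah BH AH p r) (Kn (conv T (C1c w Bh Ah BH AH p r) u)) t)"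

definition CR_op ::
    "real \<Rightarrow> real \<Rightarrow> real^'n^'n \<Rightarrow> real^'n^'n \<Rightarrow> real^'m^'m \<Rightarrow> real^'m^'m \<Rightarrow>
      real^'m^'n \<Rightarrow> real^'n^'m \<Rightarrow> ((real \<Rightarrow> complex^'n) \<Rightarrow> (real \<Rightarrow> complex^'n)) \<Rightarrow>
      (real \<Rightarrow> complex^'n) \<Rightarrow> (real \<Rightarrow> complex^'n)" where
  "CR_op T w Bh Ah BH AH p r Kn u =
     (\<lambda>t. matrix_op (mat 1 - coarse_mat Bh BH p r) (CR_inner w Bh BH p r Kn u) t
        + CR_c T w Bh Ah BH AH p r Kn u t)"

definition two_grid_op ::
    "real \<Rightarrow> real \<Rightarrow> real^'n^'n \<Rightarrow> real^'n^'n \<Rightarrow> real^'m^'m \<Rightarrow> real^'m^'m \<Rightarrow>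
      real^'m^'n \<Rightarrow> real^'n^'m \<Rightarrow> ((real \<Rightarrow> complex^'n) \<Rightarrow> (real \<Rightarrow> complex^'n)) \<Rightarrow>
      nat \<Rightarrow> nat \<Rightarrow> nat \<Rightarrow> (real \<Rightarrow> complex^'n) \<Rightarrow> (real \<Rightarrow> complex^'n)" where
  "two_grid_op T w Bh Ah BH AH p r K \<nu>\<^sub>1 \<nu>\<^sub>2 \<nu>\<^sub>3 u =
     (K ^^ \<nu>\<^sub>3) (CR_op T w Bh Ah BH AH p r (K ^^ \<nu>\<^sub>2) ((K ^^ \<nu>\<^sub>1) u))"

end

(*
  The two-grid operator is a matrix plus an operator V with
  |V u(t)| <= K * (integral of |u| over [0,t]); operators of this form are closed under sums and
  compositions, and their matrix parts add and multiply. Such a V is quasinilpotent: by induction,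
  |V^n u(t)| <= (K t)^n / n! * sup |u|. So if mu is not an eigenvalue of the matrix part A, the
  Neumann series inverts mu - A - V. Conversely, evaluation at t = 0 annihilates V, so
  invertibility of mu - A - V makes mu - A surjective. Hence both spectra coincide.
*)
theory Submission
  imports Defs
begin

section \<open>Continuous functions on \<open>[0,T]\<close>\<close>

text \<open>Two points shape the argument. First, the correction operator contains several nested
  convolutions, but each summand of \<open>CR_c\<close> has at least one convolution as a factor.
  Operators with matrix part 0 absorb products on both sides, so the whole of \<open>CR_c\<close>
  has matrix part 0 and only the convolution-free part of the operator reaches the spectrum. Second,
  the resolvent has to be a bounded linear operator on functions represented by their extension by
  zero. It is not written down as an operator series: the equation is solved for one right-hand side
  at a time, with a bound whose constant does not depend on that side. Choosing solutions then gives
  a map whose linearity follows from uniqueness. In the converse direction surjectivity on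
  \<open>complex^'n\<close> is enough, since in finite dimension it already implies
  invertibility.\<close>

lemma bounded_bilinear_complex_matrix_vector_mult:
  "bounded_bilinear (\<lambda>(A::real^'m^'n) (x::complex^'m). complex_matrix A *v x)"
proof -
  have "bilinear (\<lambda>(A::real^'m^'n) (x::complex^'m). complex_matrix A *v x)"
    unfolding bilinear_def
    by (auto intro!: linearI simp: vec_eq_iff matrix_vector_mult_def sum.distrib algebra_simps
        scaleR_conv_of_real[where 'a = complex] sum_distrib_left)
  then show ?thesis
    by (simp add: bilinear_conv_bounded_bilinear)
qed

lemma bounded_linear_matrix_vector_mult: "bounded_linear (\<lambda>x::complex^'m. A *v x)"
  by (simp add: linear_conv_bounded_linear[symmetric])

lemma matrix_vector_mult_bound:
  fixes A :: "complex^'m^'n"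
  obtains K where "K \<ge> 0" "\<And>x. norm (A *v x) \<le> K * norm x"
  using bounded_linear.nonneg_bounded[OF bounded_linear_matrix_vector_mult, of A]
  by (metis mult.commute)

lemma bounded_bilinear_matrix_mult:
  "bounded_bilinear (\<lambda>(A::real^'m^'n) (B::real^'k^'m). A ** B)"
proof -
  have "bilinear (\<lambda>(A::real^'m^'n) (B::real^'k^'m). A ** B)"
    unfolding bilinear_def
    by (auto intro!: linearI simp: vec_eq_iff matrix_matrix_mult_def sum.distrib algebra_simps
        sum_distrib_left)
  then show ?thesis
    by (simp add: bilinear_conv_bounded_bilinear)
qed

lemma C_space_norm_integrable:
  assumes "u \<in> C_space T" "t \<in> {0..T}"
  shows "(\<lambda>s. norm (u s)) integrable_on {0..t}"
proof -
  have "continuous_on {0..t} u"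
    using assms by (auto simp: C_space_def intro: continuous_on_subset)
  then show ?thesis
    by (intro integrable_continuous_interval continuous_intros)
qed

lemma C_space_norm_integral_mono:
  assumes "u \<in> C_space T" "s \<in> {0..t}" "t \<in> {0..T}"
  shows "integral {0..s} (\<lambda>s. norm (u s)) \<le> integral {0..t} (\<lambda>s. norm (u s))"
  using assms by (intro integral_subset_le C_space_norm_integrable) auto

lemma C_space_norm_integral_le:
  assumes "u \<in> C_space T" "t \<in> {0..T}" "\<And>s. s \<in> {0..T} \<Longrightarrow> norm (u s) \<le> S" "T \<ge> 0"
  shows "integral {0..t} (\<lambda>s. norm (u s)) \<le> T * S"
proof -
  have "S \<ge> 0"
    using order_trans[OF norm_ge_zero assms(3)[of 0]] \<open>T \<ge> 0\<close> by simp
  have "integral {0..t} (\<lambda>s. norm (u s)) \<le> integral {0..t} (\<lambda>_. S)"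
    using assms by (intro integral_le C_space_norm_integrable) auto
  also have "\<dots> = t * S"
    using assms by simp
  also have "\<dots> \<le> T * S"
    using assms \<open>S \<ge> 0\<close> by (intro mult_right_mono) auto
  finally show ?thesis .
qed

text \<open>A supremum of reals is an upper bound only for sets that are bounded above; compactness
  of \<open>{0..T}\<close> provides this.\<close>

lemma C_space_norm_le_sup_norm:
  assumes "u \<in> C_space T" "t \<in> {0..T}"
  shows "norm (u t) \<le> sup_norm T u"
proof -
  have "continuous_on {0..T} (\<lambda>t. norm (u t))"
    using assms by (intro continuous_intros) (simp add: C_space_def)
  then have "bdd_above ((\<lambda>t. norm (u t)) ` {0..T})"
    by (intro bounded_imp_bdd_above compact_imp_bounded compact_continuous_image) auto
  then show ?thesis
    unfolding sup_norm_def using assms by (intro cSUP_upper)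
qed

lemma sup_norm_le:
  assumes "T \<ge> 0" "\<And>t. t \<in> {0..T} \<Longrightarrow> norm (u t) \<le> S"
  shows "sup_norm T u \<le> S"
  unfolding sup_norm_def using assms by (intro cSUP_least) auto

lemma C_space_add: "u \<in> C_space T \<Longrightarrow> v \<in> C_space T \<Longrightarrow> (\<lambda>t. u t + v t) \<in> C_space T"
  by (auto simp: C_space_def intro: continuous_intros)

lemma C_space_diff: "u \<in> C_space T \<Longrightarrow> v \<in> C_space T \<Longrightarrow> (\<lambda>t. u t - v t) \<in> C_space T"
  by (auto simp: C_space_def intro: continuous_intros)

lemma C_space_matrix: "u \<in> C_space T \<Longrightarrow> (\<lambda>t. A *v u t) \<in> C_space T"
  unfolding C_space_def
  using bounded_linear.continuous_on[OF bounded_linear_matrix_vector_mult, of "{0..T}" u A]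
  by auto

text \<open>Scalars are treated as matrices \<open>mat c\<close>, so that scalar multiples and the
  shift by a spectral parameter become special cases of matrix operators.\<close>

lemma mat_mult_vector: "mat c *v x = c *s (x :: 'a::comm_semiring_1^'n)"
  by (simp add: vec_eq_iff matrix_vector_mult_def mat_def if_distrib[of "\<lambda>y. y * _"] cong: if_cong)

lemma C_space_smult: "u \<in> C_space T \<Longrightarrow> (\<lambda>t. c *s u t) \<in> C_space T"
  using C_space_matrix[of u T "mat c"] by (simp add: mat_mult_vector)

section \<open>Volterra perturbations of matrices\<close>

text \<open>The Volterra part \<open>L - A\<close> is only required to satisfy an integral estimate: this is stable
  under composition, so no kernels of composed convolutions have to be computed.\<close>

definition volterra_split ::
    "real \<Rightarrow> complex^'n^'n \<Rightarrow> ((real \<Rightarrow> complex^'n) \<Rightarrow> (real \<Rightarrow> complex^'n)) \<Rightarrow> bool" where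
  "volterra_split T A L \<longleftrightarrow>
     (\<forall>u\<in>C_space T. L u \<in> C_space T) \<and>
     (\<forall>u\<in>C_space T. \<forall>v\<in>C_space T. L (\<lambda>t. u t + v t) = (\<lambda>t. L u t + L v t)) \<and>
     (\<forall>c. \<forall>u\<in>C_space T. L (\<lambda>t. c *s u t) = (\<lambda>t. c *s L u t)) \<and>
     (\<exists>K\<ge>0. \<forall>u\<in>C_space T. \<forall>t\<in>{0..T}.
        norm (L u t - A *v u t) \<le> K * integral {0..t} (\<lambda>s. norm (u s)))"

lemma volterra_splitD:
  assumes "volterra_split T A L"
  shows volterra_split_closed: "u \<in> C_space T \<Longrightarrow> L u \<in> C_space T"
    and volterra_split_add_arg:
      "u \<in> C_space T \<Longrightarrow> v \<in> C_space T \<Longrightarrow> L (\<lambda>t. u t + v t) = (\<lambda>t. L u t + L v t)"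
    and volterra_split_smult_arg: "u \<in> C_space T \<Longrightarrow> L (\<lambda>t. c *s u t) = (\<lambda>t. c *s L u t)"
  using assms by (auto simp: volterra_split_def)

lemma volterra_split_bound:
  assumes "volterra_split T A L"
  obtains K where "K \<ge> 0" "\<And>u t. u \<in> C_space T \<Longrightarrow> t \<in> {0..T} \<Longrightarrow>
    norm (L u t - A *v u t) \<le> K * integral {0..t} (\<lambda>s. norm (u s))"
  using assms unfolding volterra_split_def by blast

lemma volterra_split_diff_arg:
  assumes "volterra_split T A L" "u \<in> C_space T" "v \<in> C_space T"
  shows "L (\<lambda>t. u t - v t) = (\<lambda>t. L u t - L v t)"
proof -
  note volterra_split_add_arg[OF assms(1,2) C_space_smult[OF assms(3), of "-1"]]
  also note volterra_split_smult_arg[OF assms(1,3), of "-1"]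
  finally show ?thesis
    by simp
qed

section \<open>Sums and products of matrices with Volterra perturbations\<close>

lemma volterra_split_matrix: "volterra_split T A (\<lambda>u t. A *v u t)"
  unfolding volterra_split_def
  by (auto simp: C_space_matrix matrix_vector_right_distrib vector_scalar_commute
      intro!: exI[of _ 0])

lemma volterra_split_add:
  assumes L: "volterra_split T A L" and M: "volterra_split T B M"
  shows "volterra_split T (A + B) (\<lambda>u t. L u t + M u t)"
proof -
  obtain K where K: "K \<ge> 0" "\<And>u t. u \<in> C_space T \<Longrightarrow> t \<in> {0..T} \<Longrightarrow>
      norm (L u t - A *v u t) \<le> K * integral {0..t} (\<lambda>s. norm (u s))"
    using volterra_split_bound[OF L] by blast
  obtain K' where K': "K' \<ge> 0" "\<And>u t. u \<in> C_space T \<Longrightarrow> t \<in> {0..T} \<Longrightarrow>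
      norm (M u t - B *v u t) \<le> K' * integral {0..t} (\<lambda>s. norm (u s))"
    using volterra_split_bound[OF M] by blast
  have "norm (L u t + M u t - (A + B) *v u t) \<le> (K + K') * integral {0..t} (\<lambda>s. norm (u s))"
    if "u \<in> C_space T" "t \<in> {0..T}" for u t
  proof -
    have "L u t + M u t - (A + B) *v u t = (L u t - A *v u t) + (M u t - B *v u t)"
      by (simp add: matrix_vector_mult_add_rdistrib)
    also have "norm \<dots> \<le> norm (L u t - A *v u t) + norm (M u t - B *v u t)"
      by (rule norm_triangle_ineq)
    finally show ?thesis
      using K(2)[OF that] K'(2)[OF that] by (simp add: distrib_right)
  qed
  moreover have "K + K' \<ge> 0"
    using K K' by simp
  ultimately have "\<exists>K\<ge>0. \<forall>u\<in>C_space T. \<forall>t\<in>{0..T}.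
      norm (L u t + M u t - (A + B) *v u t) \<le> K * integral {0..t} (\<lambda>s. norm (u s))"
    by blast
  then show ?thesis
    using volterra_splitD[OF L] volterra_splitD[OF M]
    by (simp add: volterra_split_def C_space_add vector_add_ldistrib add_ac)
qed

text \<open>Based on \<open>L M - A B = (L - A) M + A (M - B)\<close>. The second term is controlled
  directly; the first needs the integral of \<open>norm (M u s)\<close> to be bounded by that of
  \<open>norm (u s)\<close>.\<close>

lemma volterra_split_compose:
  assumes L: "volterra_split T A L" and M: "volterra_split T B M"
  shows "volterra_split T (A ** B) (\<lambda>u. L (M u))"
proof -
  obtain K where K: "K \<ge> 0" "\<And>u t. u \<in> C_space T \<Longrightarrow> t \<in> {0..T} \<Longrightarrow>
      norm (L u t - A *v u t) \<le> K * integral {0..t} (\<lambda>s. norm (u s))"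
    using volterra_split_bound[OF L] by blast
  obtain K' where K': "K' \<ge> 0" "\<And>u t. u \<in> C_space T \<Longrightarrow> t \<in> {0..T} \<Longrightarrow>
      norm (M u t - B *v u t) \<le> K' * integral {0..t} (\<lambda>s. norm (u s))"
    using volterra_split_bound[OF M] by blast
  obtain a where a: "a \<ge> 0" "\<And>x. norm (A *v x) \<le> a * norm x"
    using matrix_vector_mult_bound by blast
  obtain b where b: "b \<ge> 0" "\<And>x. norm (B *v x) \<le> b * norm x"
    using matrix_vector_mult_bound by blast
  \<comment> \<open>The factor \<open>b + K' * \<bar>T\<bar>\<close> bounds the integral of
    \<open>norm (M u s)\<close>, and \<open>a * K'\<close> comes from the term
    \<open>A (M - B)\<close>. The absolute value makes \<open>D\<close> nonnegative for every real
    \<open>T\<close>.\<close>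
  define D where "D = K * (b + K' * \<bar>T\<bar>) + a * K'"
  have bound: "norm (L (M u) t - (A ** B) *v u t) \<le> D * integral {0..t} (\<lambda>s. norm (u s))"
    if u: "u \<in> C_space T" and t: "t \<in> {0..T}" for u t
  proof -
    let ?I = "\<lambda>t. integral {0..t} (\<lambda>s. norm (u s))"
    have Mu: "M u \<in> C_space T"
      using volterra_split_closed[OF M u] .
    have "integral {0..t} (\<lambda>s. norm (M u s)) \<le> integral {0..t} (\<lambda>s. b * norm (u s) + K' * ?I t)"
    proof (rule integral_le)
      fix s assume s: "s \<in> {0..t}"
      have "norm (M u s) \<le> norm (B *v u s) + norm (M u s - B *v u s)"
        by (metis add.commute diff_add_cancel norm_triangle_ineq)
      also have "\<dots> \<le> b * norm (u s) + K' * ?I s"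
        using s t u K'(2)[OF u] b(2) by (intro add_mono) auto
      \<comment> \<open>By monotonicity the inner integral is replaced by a value independent of
        \<open>s\<close>; integrating it over \<open>{0..t}\<close> then costs only a factor
        \<open>t\<close>.\<close>
      also have "\<dots> \<le> b * norm (u s) + K' * ?I t"
        using C_space_norm_integral_mono[OF u s t] K'(1) b(1) by (intro add_mono mult_left_mono) auto
      finally show "norm (M u s) \<le> b * norm (u s) + K' * ?I t" .
    qed (use C_space_norm_integrable[OF Mu t] C_space_norm_integrable[OF u t] in
        \<open>auto intro!: integrable_add integrable_on_mult_right\<close>)
    also have "\<dots> = b * ?I t + t * (K' * ?I t)"
      using C_space_norm_integrable[OF u t] t
      by (subst integral_add) (auto intro!: integrable_on_mult_right)
    also have "\<dots> \<le> b * ?I t + \<bar>T\<bar> * (K' * ?I t)"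
      using t K' C_space_norm_integrable[OF u t]
      by (intro add_mono mult_right_mono mult_nonneg_nonneg integral_nonneg) auto
    finally have M_int: "integral {0..t} (\<lambda>s. norm (M u s)) \<le> (b + K' * \<bar>T\<bar>) * ?I t"
      by (simp add: algebra_simps)
    have "norm (L (M u) t - (A ** B) *v u t)
        = norm ((L (M u) t - A *v M u t) + A *v (M u t - B *v u t))"
      by (simp add: matrix_vector_mult_diff_distrib matrix_vector_mul_assoc)
    also have "\<dots> \<le> norm (L (M u) t - A *v M u t) + norm (A *v (M u t - B *v u t))"
      by (rule norm_triangle_ineq)
    also have "\<dots> \<le> K * integral {0..t} (\<lambda>s. norm (M u s)) + a * norm (M u t - B *v u t)"
      using K(2)[OF Mu t] a by (intro add_mono)
    also have "\<dots> \<le> K * ((b + K' * \<bar>T\<bar>) * ?I t) + a * (K' * ?I t)"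
      using M_int K'(2)[OF u t] K(1) a(1) by (intro add_mono mult_left_mono)
    finally show ?thesis
      by (simp add: D_def algebra_simps)
  qed
  have "D \<ge> 0"
    using K(1) K'(1) a(1) b(1) by (simp add: D_def)
  with bound have "\<exists>K\<ge>0. \<forall>u\<in>C_space T. \<forall>t\<in>{0..T}.
      norm (L (M u) t - (A ** B) *v u t) \<le> K * integral {0..t} (\<lambda>s. norm (u s))"
    by blast
  then show ?thesis
    using volterra_splitD[OF L] volterra_splitD[OF M]
    by (simp add: volterra_split_def)
qed

lemma volterra_split_id: "volterra_split T (mat 1) (\<lambda>u. u)"
  using volterra_split_matrix[of T "mat 1"] by simp

lemma volterra_split_scaleR:
  assumes "volterra_split T A L"
  shows "volterra_split T (w *\<^sub>R A) (\<lambda>u t. w *\<^sub>R L u t)"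
proof -
  have eq: "mat (complex_of_real w) *v x = w *\<^sub>R x" for x :: "complex^'n"
    by (simp add: mat_mult_vector vec_eq_iff scaleR_conv_of_real[where 'a = complex])
  have "mat (complex_of_real w) ** A = w *\<^sub>R A"
    by (simp add: vec_eq_iff matrix_matrix_mult_def mat_def if_distrib[of "\<lambda>y. y * _"]
        scaleR_conv_of_real[where 'a = complex] cong: if_cong)
  then show ?thesis
    using volterra_split_compose[OF volterra_split_matrix assms, of "mat (complex_of_real w)"]
    by (simp add: eq)
qed

lemma volterra_split_diff:
  assumes "volterra_split T A L" "volterra_split T B M"
  shows "volterra_split T (A - B) (\<lambda>u t. L u t - M u t)"
  using volterra_split_add[OF assms(1) volterra_split_scaleR[OF assms(2), of "-1"]] by simp

lemma volterra_split_bounded_operator: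
  assumes L: "volterra_split T A L" and "T \<ge> 0"
  shows "bounded_operator T L"
proof -
  obtain K where K: "K \<ge> 0" "\<And>u t. u \<in> C_space T \<Longrightarrow> t \<in> {0..T} \<Longrightarrow>
      norm (L u t - A *v u t) \<le> K * integral {0..t} (\<lambda>s. norm (u s))"
    using volterra_split_bound[OF L] by blast
  obtain a where a: "a \<ge> 0" "\<And>x. norm (A *v x) \<le> a * norm x"
    using matrix_vector_mult_bound by blast
  have "sup_norm T (L u) \<le> (K * T + a) * sup_norm T u" if u: "u \<in> C_space T" for u
  proof (rule sup_norm_le[OF \<open>T \<ge> 0\<close>])
    fix t assume t: "t \<in> {0..T}"
    have "norm (L u t) \<le> norm (L u t - A *v u t) + norm (A *v u t)"
      by (metis diff_add_cancel norm_triangle_ineq)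
    also have "\<dots> \<le> K * integral {0..t} (\<lambda>s. norm (u s)) + a * norm (u t)"
      using K(2)[OF u t] a(2) by (intro add_mono)
    also have "\<dots> \<le> K * (T * sup_norm T u) + a * sup_norm T u"
      using C_space_norm_integral_le[OF u t C_space_norm_le_sup_norm[OF u] \<open>T \<ge> 0\<close>]
        C_space_norm_le_sup_norm[OF u t] K(1) a(1)
      by (intro add_mono mult_left_mono)
    finally show "norm (L u t) \<le> (K * T + a) * sup_norm T u"
      by (simp add: algebra_simps)
  qed
  then show ?thesis
    using volterra_splitD[OF L] by (auto simp: bounded_operator_def)
qed

section \<open>Factorial bounds and fixed points of Volterra operators\<close>

lemma has_integral_power_fact:
  assumes "t \<ge> (0::real)"
  shows "((\<lambda>s. (K * s) ^ n / fact n * K) has_integral (K * t) ^ Suc n / fact (Suc n)) {0..t}"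
proof -
  have "((\<lambda>s. (K * s) ^ n / fact n * K) has_integral
      (K * t) ^ Suc n / fact (Suc n) - (K * 0) ^ Suc n / fact (Suc n)) {0..t}"
  proof (rule fundamental_theorem_of_calculus[OF assms])
    fix s
    have "((\<lambda>s. (K * s) ^ Suc n / fact (Suc n)) has_real_derivative
        (of_nat (Suc n) * (K * s) ^ n * K) / fact (Suc n)) (at s within {0..t})"
      by (rule derivative_eq_intros refl | simp)+
    then show "((\<lambda>s. (K * s) ^ Suc n / fact (Suc n)) has_vector_derivative
        (K * s) ^ n / fact n * K) (at s within {0..t})"
      by (simp add: has_real_derivative_iff_has_vector_derivative divide_simps mult_ac del: of_nat_Suc)
  qed
  then show ?thesis
    by simp
qed

text \<open>The bound must depend on \<open>t\<close>: integrating the power of \<open>t\<close>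
  produces the factorial, whereas a bound by the supremum over \<open>{0..T}\<close> would yield
  only powers of \<open>K * T\<close>. Membership in \<open>C_space T\<close> belongs to the
  induction because the estimate for \<open>W\<close> applies to such functions.\<close>

lemma volterra_power_bound:
  assumes W: "volterra_split T 0 W" and "K \<ge> 0"
    and K: "\<And>u t. u \<in> C_space T \<Longrightarrow> t \<in> {0..T} \<Longrightarrow>
      norm (W u t) \<le> K * integral {0..t} (\<lambda>s. norm (u s))"
    and u: "u \<in> C_space T" "\<And>t. t \<in> {0..T} \<Longrightarrow> norm (u t) \<le> S" and "t \<in> {0..T}"
  shows "(W ^^ n) u \<in> C_space T \<and> norm ((W ^^ n) u t) \<le> S * ((K * t) ^ n / fact n)"
  using \<open>t \<in> {0..T}\<close>
proof (induction n arbitrary: t)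
  case 0
  then show ?case using u by simp
next
  case (Suc n)
  let ?v = "(W ^^ n) u"
  have v: "?v \<in> C_space T"
    using Suc by blast
  have "norm (W ?v t) \<le> K * integral {0..t} (\<lambda>s. norm (?v s))"
    using K[OF v Suc.prems] .
  also have "\<dots> = integral {0..t} (\<lambda>s. K * norm (?v s))"
    by simp
  also have "\<dots> \<le> integral {0..t} (\<lambda>s. S * ((K * s) ^ n / fact n * K))"
  proof (rule integral_le)
    show "(\<lambda>s. K * norm (?v s)) integrable_on {0..t}"
      using C_space_norm_integrable[OF v Suc.prems] by (intro integrable_on_mult_right)
    show "(\<lambda>s. S * ((K * s) ^ n / fact n * K)) integrable_on {0..t}"
      by (intro integrable_continuous_interval continuous_intros) auto
    fix s assume "s \<in> {0..t}"
    then have "norm (?v s) \<le> S * ((K * s) ^ n / fact n)"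
      using Suc by auto
    from mult_left_mono[OF this \<open>K \<ge> 0\<close>]
    show "K * norm (?v s) \<le> S * ((K * s) ^ n / fact n * K)"
      by (simp add: mult_ac)
  qed
  also have "\<dots> = S * ((K * t) ^ Suc n / fact (Suc n))"
    using has_integral_mult_right[OF has_integral_power_fact[of t K n], of S] Suc.prems
    by (intro integral_unique) auto
  finally show ?case
    using volterra_split_closed[OF W v] by simp
qed

text \<open>A fixed point equals all its iterates, so the factorial bound holds for \<open>u\<close>
  itself with every \<open>n\<close> and forces it to vanish.\<close>

lemma volterra_fixpoint_zero:
  assumes W: "volterra_split T 0 W" and u: "u \<in> C_space T" "u = W u"
  shows "u = (\<lambda>t. 0)"
proof
  fix t
  obtain K where K: "K \<ge> 0" "\<And>u t. u \<in> C_space T \<Longrightarrow> t \<in> {0..T} \<Longrightarrow>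
      norm (W u t) \<le> K * integral {0..t} (\<lambda>s. norm (u s))"
    using volterra_split_bound[OF W] by auto
  show "u t = 0"
  proof (cases "t \<in> {0..T}")
    case True
    have iter: "(W ^^ n) u = u" for n
      by (induction n) (use u in auto)
    have "norm (u t) \<le> sup_norm T u * ((K * t) ^ n / fact n)" for n
      using volterra_power_bound[OF W K u(1) C_space_norm_le_sup_norm[OF u(1)] True, of n]
      by (simp add: iter)
    moreover have "(\<lambda>n. sup_norm T u * ((K * t) ^ n / fact n)) \<longlonglongrightarrow> sup_norm T u * 0"
      using summable_LIMSEQ_zero[OF summable_exp[of "K * t"]]
      by (intro tendsto_mult tendsto_const) (simp add: divide_inverse mult.commute)
    ultimately have "norm (u t) \<le> sup_norm T u * 0"
      by (intro LIMSEQ_le_const) auto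
    then show ?thesis by simp
  qed (use u in \<open>auto simp: C_space_def\<close>)
qed

text \<open>The Neumann series applied to \<open>g\<close>. The constant \<open>D\<close> is chosen
  before \<open>g\<close>, which later makes the resolvent bounded.\<close>

lemma volterra_fixpoint_exists:
  assumes W: "volterra_split T 0 W" and "T \<ge> 0"
  obtains D where "\<And>g. g \<in> C_space T \<Longrightarrow>
    \<exists>u\<in>C_space T. u = (\<lambda>t. g t + W u t) \<and> sup_norm T u \<le> D * sup_norm T g"
proof -
  obtain K where K: "K \<ge> 0" "\<And>u t. u \<in> C_space T \<Longrightarrow> t \<in> {0..T} \<Longrightarrow>
      norm (W u t) \<le> K * integral {0..t} (\<lambda>s. norm (u s))"
    using volterra_split_bound[OF W] by auto
  have "\<exists>u\<in>C_space T. u = (\<lambda>t. g t + W u t) \<and> sup_norm T u \<le> exp (K * T) * sup_norm T g"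
    if g: "g \<in> C_space T" for g
  proof -
    let ?S = "sup_norm T g"
    \<comment> \<open>The factorial bound at the right end point \<open>t = T\<close>. It majorizes
      the terms on the whole interval, and its sum \<open>exp (K * T) * ?S\<close> supplies
      \<open>D\<close>.\<close>
    define a where "a n = ?S * ((K * T) ^ n / fact n)" for n
    define s where "s n = (\<lambda>t. \<Sum>i<n. (W ^^ i) g t)" for n
    define u where "u = (\<lambda>t. \<Sum>i. (W ^^ i) g t)"
    have "?S \<ge> 0"
      using C_space_norm_le_sup_norm[OF g, of 0] \<open>T \<ge> 0\<close> order_trans[OF norm_ge_zero] by auto
    have closed: "(W ^^ i) g \<in> C_space T" for i
      by (induction i) (auto simp: g intro: volterra_split_closed[OF W])
    have term_bound: "norm ((W ^^ i) g t) \<le> a i" if t: "t \<in> {0..T}" for i t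
    proof -
      have "norm ((W ^^ i) g t) \<le> ?S * ((K * t) ^ i / fact i)"
        using volterra_power_bound[OF W K g C_space_norm_le_sup_norm[OF g] t] by blast
      also have "\<dots> \<le> a i"
        unfolding a_def using t K(1) \<open>?S \<ge> 0\<close>
        by (intro mult_left_mono divide_right_mono power_mono) auto
      finally show ?thesis .
    qed
    have a_sums: "a sums (?S * exp (K * T))"
      unfolding a_def using exp_converges[of "K * T"]
      by (intro sums_mult) (simp add: divide_inverse mult.commute)
    have unif: "uniform_limit {0..T} s u sequentially"
      unfolding s_def u_def using term_bound sums_summable[OF a_sums]
      by (intro Weierstrass_m_test) auto
    have s_closed: "s n \<in> C_space T" for n
    proof (induction n)
      case 0
      show ?case by (simp add: s_def C_space_def)
    next
      case (Suc n)
      then show ?case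
        using C_space_add[OF _ closed[of n]] by (simp add: s_def)
    qed
    have u_closed: "u \<in> C_space T"
      using uniform_limit_theorem[OF _ unif] s_closed closed
      by (auto simp: C_space_def u_def)
    \<comment> \<open>Applying \<open>W\<close> shifts the index: the terms 0 to
      \<open>n - 1\<close> become the terms 1 to \<open>n\<close>, which is the next partial sum
      without its first term \<open>g\<close>.\<close>
    have W_s: "W (s n) = (\<lambda>t. s (Suc n) t - g t)" for n
    proof (induction n)
      case 0
      have "W (\<lambda>t. 0 *s g t) = (\<lambda>t. 0 *s W g t)"
        by (rule volterra_split_smult_arg[OF W g])
      then show ?case by (simp add: s_def)
    next
      case (Suc n)
      have "W (s (Suc n)) = W (\<lambda>t. s n t + (W ^^ n) g t)"
        by (simp add: s_def)
      also have "\<dots> = (\<lambda>t. W (s n) t + (W ^^ Suc n) g t)"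
        using volterra_split_add_arg[OF W s_closed closed] by simp
      finally show ?case
        unfolding Suc by (simp add: s_def fun_eq_iff)
    qed
    have W_u: "W u t = u t - g t" for t
    proof (cases "t \<in> {0..T}")
      case True
      have "(\<lambda>n. W (s n) t) \<longlonglongrightarrow> W u t"
      proof (rule tendstoI)
        fix e :: real assume "e > 0"
        \<comment> \<open>The integral estimate turns a uniform error \<open>d\<close> into at most
          \<open>K * T * d\<close>. Adding 1 in the denominator covers the case
          \<open>K * T = 0\<close>, and the factor 2 makes the final inequality strict.\<close>
        define d where "d = e / (2 * (K * T + 1))"
        have "K * T \<ge> 0" using K(1) \<open>T \<ge> 0\<close> by simp
        then have "d > 0" using \<open>e > 0\<close> by (simp add: d_def)
        have "K * (T * d) \<le> e / 2"
          using \<open>K * T \<ge> 0\<close> \<open>e > 0\<close> by (simp add: d_def field_simps)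
        from uniform_limitD[OF unif \<open>d > 0\<close>]
        show "\<forall>\<^sub>F n in sequentially. dist (W (s n) t) (W u t) < e"
        proof eventually_elim
          case (elim n)
          have "dist (W (s n) t) (W u t) = norm (W (\<lambda>t. s n t - u t) t)"
            using volterra_split_diff_arg[OF W s_closed u_closed] by (simp add: dist_norm)
          also have "\<dots> \<le> K * integral {0..t} (\<lambda>t. norm (s n t - u t))"
            using K(2)[OF C_space_diff[OF s_closed u_closed] True] .
          also have "\<dots> \<le> K * (T * d)"
            using elim K(1) \<open>T \<ge> 0\<close> True
            by (intro mult_left_mono C_space_norm_integral_le C_space_diff s_closed u_closed)
              (auto simp: dist_norm intro: less_imp_le)
          finally show ?case
            using \<open>K * (T * d) \<le> e / 2\<close> \<open>e > 0\<close> by simp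
        qed
      qed
      moreover have "(\<lambda>n. W (s n) t) \<longlonglongrightarrow> u t - g t"
        unfolding W_s
        by (intro tendsto_diff tendsto_const LIMSEQ_Suc tendsto_uniform_limitI[OF unif True])
      ultimately show ?thesis
        by (rule LIMSEQ_unique)
    qed (use u_closed g volterra_split_closed[OF W u_closed] in \<open>auto simp: C_space_def\<close>)
    have "norm (u t) \<le> exp (K * T) * ?S" if t: "t \<in> {0..T}" for t
    proof -
      have "norm (u t) \<le> (\<Sum>i. a i)"
        unfolding u_def using term_bound[OF t] sums_summable[OF a_sums]
        by (intro norm_suminf_le)
      then show ?thesis
        using sums_unique[OF a_sums] by (simp add: mult.commute)
    qed
    from sup_norm_le[OF \<open>T \<ge> 0\<close> this] show ?thesis
      using u_closed W_u by (intro bexI[of _ u]) auto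
  qed
  then show ?thesis
    using that by blast
qed

text \<open>Multiplying by the inverse of the matrix part turns \<open>L\<close> into the identity minus a
  Volterra operator.\<close>

lemma volterra_split_invertible:
  fixes A G :: "complex^'n^'n"
  assumes L: "volterra_split T A L" and "T \<ge> 0" and G: "A ** G = mat 1" "G ** A = mat 1"
  shows "\<exists>R. bounded_operator T R \<and> (\<forall>u\<in>C_space T. R (L u) = u \<and> L (R u) = u)"
proof -
  define W where "W = (\<lambda>u t. u t - G *v L u t)"
  \<comment> \<open>The matrix part of \<open>W\<close> is \<open>mat 1 - G ** A = 0\<close>. The
    other identity, \<open>A ** G = mat 1\<close>, serves below to remove \<open>G\<close> from the
    equation for \<open>u\<close>.\<close>
  have W: "volterra_split T 0 W"
    using volterra_split_diff[OF volterra_split_id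
        volterra_split_compose[OF volterra_split_matrix L, of G]] G
    by (simp add: W_def)
  have inj: "u = (\<lambda>t. 0)" if "u \<in> C_space T" "L u = (\<lambda>t. 0)" for u
    using volterra_fixpoint_zero[OF W that(1)] that(2) by (simp add: W_def)
  obtain D where D: "\<And>g. g \<in> C_space T \<Longrightarrow>
      \<exists>u\<in>C_space T. u = (\<lambda>t. g t + W u t) \<and> sup_norm T u \<le> D * sup_norm T g"
    using volterra_fixpoint_exists[OF W \<open>T \<ge> 0\<close>] by blast
  obtain k where k: "k \<ge> 0" "\<And>x. norm (G *v x) \<le> k * norm x"
    using matrix_vector_mult_bound by blast
  \<comment> \<open>The equation \<open>L u = f\<close> is equivalent to
    \<open>u = G f + W u\<close>. The sign of \<open>D\<close> is unknown, so
    \<open>\<bar>D\<bar>\<close> is needed when \<open>sup_norm T ?g\<close> is replaced by its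
    upper bound.\<close>
  have "\<exists>u\<in>C_space T. L u = f \<and> sup_norm T u \<le> \<bar>D\<bar> * (k * sup_norm T f)"
    if f: "f \<in> C_space T" for f
  proof -
    let ?g = "\<lambda>t. G *v f t"
    obtain u where u: "u \<in> C_space T" "u = (\<lambda>t. ?g t + W u t)"
        "sup_norm T u \<le> D * sup_norm T ?g"
      using D[OF C_space_matrix[OF f]] by blast
    have "G *v L u t = G *v f t" for t
      using fun_cong[OF u(2), of t] by (simp add: W_def)
    then have "(A ** G) *v L u t = (A ** G) *v f t" for t
      by (metis matrix_vector_mul_assoc)
    then have "L u = f"
      by (simp add: G fun_eq_iff)
    moreover have norm_g: "sup_norm T ?g \<le> k * sup_norm T f"
      using k(2) mult_left_mono[OF C_space_norm_le_sup_norm[OF f] k(1)]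
      by (intro sup_norm_le[OF \<open>T \<ge> 0\<close>]) (meson order_trans)
    moreover have "sup_norm T ?g \<ge> 0"
      using C_space_norm_le_sup_norm[OF C_space_matrix[OF f], of 0] \<open>T \<ge> 0\<close>
        order_trans[OF norm_ge_zero] by auto
    ultimately show ?thesis
      using u(1,3) order_trans[OF u(3) mult_mono[of D "\<bar>D\<bar>" "sup_norm T ?g"]] by auto
  qed
  then obtain R where R: "\<And>f. f \<in> C_space T \<Longrightarrow> R f \<in> C_space T \<and> L (R f) = f \<and>
      sup_norm T (R f) \<le> \<bar>D\<bar> * (k * sup_norm T f)"
    by metis
  \<comment> \<open>Injectivity of \<open>L\<close> on \<open>C_space T\<close>. It gives linearity
    of the chosen \<open>R\<close>, since both sides of each linearity identity have the same image
    under \<open>L\<close>, and also \<open>R (L u) = u\<close>.\<close>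
  have eq: "u = v" if "u \<in> C_space T" "v \<in> C_space T" "L u = L v" for u v
  proof -
    have "(\<lambda>t. u t - v t) = (\<lambda>t. 0)"
      using that(3) volterra_split_diff_arg[OF L that(1,2)] inj[OF C_space_diff[OF that(1,2)]] by simp
    then show ?thesis
      by (simp add: fun_eq_iff)
  qed
  have "bounded_operator T R"
    unfolding bounded_operator_def
  proof (intro conjI ballI allI exI)
    fix u v :: "real \<Rightarrow> complex^'n" assume uv: "u \<in> C_space T" "v \<in> C_space T"
    show "R (\<lambda>t. u t + v t) = (\<lambda>t. R u t + R v t)"
      using R uv C_space_add volterra_split_add_arg[OF L] by - (rule eq, auto)
  next
    fix c and u :: "real \<Rightarrow> complex^'n" assume u: "u \<in> C_space T"
    show "R (\<lambda>t. c *s u t) = (\<lambda>t. c *s R u t)"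
      using R u C_space_smult volterra_split_smult_arg[OF L] by - (rule eq, auto)
  next
    fix u :: "real \<Rightarrow> complex^'n" assume "u \<in> C_space T"
    then show "sup_norm T (R u) \<le> \<bar>D\<bar> * k * sup_norm T u"
      using R by (simp add: mult.assoc)
  qed (use R in blast)
  then show ?thesis
    using R eq volterra_split_closed[OF L] by blast
qed

text \<open>At \<open>t = 0\<close> the integral vanishes, so a right inverse of \<open>L\<close> solves \<open>A x = y\<close> for every \<open>y\<close>.\<close>

lemma volterra_split_surjD:
  fixes A :: "complex^'n^'n"
  assumes L: "volterra_split T A L" and "T \<ge> 0"
    and R: "bounded_operator T R" "\<And>u. u \<in> C_space T \<Longrightarrow> L (R u) = u"
  shows "surj ((*v) A)"
unfolding surj_def
proof (intro allI exI)
  fix y :: "complex^'n"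
  \<comment> \<open>The constant function \<open>y\<close>, cut off outside the interval to match
    the representation of \<open>C[0,T]\<close>.\<close>
  define f where "f = (\<lambda>t. if t \<in> {0..T} then y else 0)"
  have f: "f \<in> C_space T"
    unfolding C_space_def f_def by (auto intro: continuous_on_eq[OF continuous_on_const])
  then have Rf: "R f \<in> C_space T"
    using R by (simp add: bounded_operator_def)
  obtain K where "K \<ge> 0" "\<And>u t. u \<in> C_space T \<Longrightarrow> t \<in> {0..T} \<Longrightarrow>
      norm (L u t - A *v u t) \<le> K * integral {0..t} (\<lambda>s. norm (u s))"
    using volterra_split_bound[OF L] by blast
  from this(2)[OF Rf, of 0] show "y = A *v R f 0"
    using \<open>T \<ge> 0\<close> R(2)[OF f] by (simp add: f_def)
qed

section \<open>Equality of the operator and matrix spectra\<close>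

lemma matrix_spectrum_iff_not_invertible:
  "\<mu> \<in> matrix_spectrum A \<longleftrightarrow> \<not> invertible (mat \<mu> - A)"
proof -
  have "(mat \<mu> - A) *v x = 0 \<longleftrightarrow> A *v x = \<mu> *s x" for x
    by (auto simp: matrix_vector_mult_diff_rdistrib mat_mult_vector)
  then show ?thesis
    unfolding matrix_spectrum_def invertible_left_inverse matrix_left_invertible_ker by auto
qed

lemma op_spectrum_volterra_split:
  assumes L: "volterra_split T A L" and "T \<ge> 0"
  shows "op_spectrum T L = matrix_spectrum A"
proof -
  have shift: "volterra_split T (mat \<mu> - A) (op_shift L \<mu>)" for \<mu>
    using volterra_split_diff[OF volterra_split_matrix[of T "mat \<mu>"] L]
    by (simp add: op_shift_def[abs_def] mat_mult_vector)
  show ?thesis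
  proof (intro set_eqI iffI)
    fix \<mu> assume "\<mu> \<in> op_spectrum T L"
    then show "\<mu> \<in> matrix_spectrum A"
      using volterra_split_invertible[OF shift \<open>T \<ge> 0\<close>, of \<mu>]
      unfolding op_spectrum_def matrix_spectrum_iff_not_invertible invertible_def by blast
  next
    fix \<mu> assume \<mu>: "\<mu> \<in> matrix_spectrum A"
    show "\<mu> \<in> op_spectrum T L"
    proof (rule ccontr)
      assume "\<mu> \<notin> op_spectrum T L"
      then have "surj ((*v) (mat \<mu> - A))"
        using volterra_split_surjD[OF shift \<open>T \<ge> 0\<close>] unfolding op_spectrum_def by blast
      with \<mu> show False
        by (simp add: matrix_spectrum_iff_not_invertible invertible_right_inverse
            matrix_right_invertible_surjective)
    qed
  qed
qed

section \<open>Convolutions with matrix exponentials\<close>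

text \<open>The substitution \<open>s = t x\<close> fixes the interval of integration.\<close>

lemma continuous_on_convolution:
  fixes k :: "real \<Rightarrow> real^'n^'n" and u :: "real \<Rightarrow> complex^'n"
  assumes k: "continuous_on {0..T} k" and u: "continuous_on {0..T} u"
  shows "continuous_on {0..T} (\<lambda>t. integral {0..t} (\<lambda>s. complex_matrix (k (t - s)) *v u s))"
proof -
  let ?h = "\<lambda>t s. complex_matrix (k (t - s)) *v u s"
  have mem: "t * x \<in> {0..T}" "t - t * x \<in> {0..T}" if "t \<in> {0..T}" "x \<in> {0..1}" for t x
  proof -
    have "0 \<le> t * x" "t * x \<le> t * 1"
      using that by (auto intro!: mult_left_mono simp del: mult_1_right)
    then show "t * x \<in> {0..T}" "t - t * x \<in> {0..T}"
      using that by auto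
  qed
  \<comment> \<open>Joint continuity on a fixed rectangle makes the parameter integral continuous;
    \<open>mem\<close> keeps both arguments inside \<open>{0..T}\<close>, where \<open>k\<close> and
    \<open>u\<close> are continuous.\<close>
  have "continuous_on ({0..T} \<times> {0..1}) (\<lambda>(t, x). ?h t (t * x))"
    unfolding case_prod_unfold
    by (intro bounded_bilinear.continuous_on[OF bounded_bilinear_complex_matrix_vector_mult]
        continuous_on_compose2[OF k] continuous_on_compose2[OF u] continuous_intros)
      (use mem in auto)
  then have "continuous_on {0..T} (\<lambda>t. t *\<^sub>R integral (cbox 0 1) (\<lambda>x. ?h t (t * x)))"
    by (intro continuous_intros integral_continuous_on_param) simp
  then show ?thesis
  proof (rule continuous_on_eq)
    fix t assume "t \<in> {0..T}"
    show "t *\<^sub>R integral (cbox 0 1) (\<lambda>x. ?h t (t * x)) = integral {0..t} (?h t)"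
    \<comment> \<open>At \<open>t = 0\<close> both sides vanish; the change of variables divides by
      \<open>t\<close>.\<close>
    proof (cases "t = 0")
      case False
      with \<open>t \<in> {0..T}\<close> have "t > 0" by auto
      have "(\<lambda>x. x / t) ` {0..t} = {0..1}"
        using \<open>t > 0\<close> image_divide_atLeastAtMost[of t 0 t] by simp
      then show ?thesis
        using integral_stretch_real[of t 0 t "?h t"] \<open>t > 0\<close> by simp
    qed simp
  qed
qed

text \<open>A continuous kernel is bounded on the compact interval, so taking norms inside the
  integral gives the required estimate, with matrix part 0.\<close>

lemma volterra_split_conv:
  fixes k :: "real \<Rightarrow> real^'n^'n"
  assumes k: "continuous_on {0..T} k"
  shows "volterra_split T 0 (conv T k)"
proof -
  obtain c where c: "c \<ge> 0" "\<And>(A::real^'n^'n) x. norm (complex_matrix A *v x) \<le> norm A * norm x * c"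
    using bounded_bilinear.nonneg_bounded[OF bounded_bilinear_complex_matrix_vector_mult] by blast
  obtain b where b: "b > 0" "\<And>t. t \<in> {0..T} \<Longrightarrow> norm (k t) \<le> b"
    using compact_imp_bounded[OF compact_continuous_image[OF k compact_Icc]]
    unfolding bounded_pos by auto
  have integrable: "(\<lambda>s. complex_matrix (k (t - s)) *v u s) integrable_on {0..t}"
    if "u \<in> C_space T" "t \<in> {0..T}" for u t
    using that
    by (intro integrable_continuous_interval
        bounded_bilinear.continuous_on[OF bounded_bilinear_complex_matrix_vector_mult]
        continuous_on_compose2[OF k] continuous_intros)
      (auto simp: C_space_def intro: continuous_on_subset)
  have bound: "norm (conv T k u t) \<le> (b * c) * integral {0..t} (\<lambda>s. norm (u s))"
    if u: "u \<in> C_space T" and t: "t \<in> {0..T}" for u t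
  proof -
    have "norm (integral {0..t} (\<lambda>s. complex_matrix (k (t - s)) *v u s))
        \<le> integral {0..t} (\<lambda>s. (b * c) * norm (u s))"
    proof (rule integral_norm_bound_integral[OF integrable[OF u t]])
      show "(\<lambda>s. (b * c) * norm (u s)) integrable_on {0..t}"
        using C_space_norm_integrable[OF u t] by (intro integrable_on_mult_right)
      fix s assume "s \<in> {0..t}"
      then have "norm (k (t - s)) * norm (u s) * c \<le> b * norm (u s) * c"
        using t c b(2)[of "t - s"] by (intro mult_right_mono) auto
      then show "norm (complex_matrix (k (t - s)) *v u s) \<le> (b * c) * norm (u s)"
        using c(2)[of "k (t - s)" "u s"] by (simp add: mult_ac)
    qed
    then show ?thesis
      using t by (simp add: conv_def)
  qed
  have "conv T k u \<in> C_space T" if "u \<in> C_space T" for u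
    using that continuous_on_eq[OF continuous_on_convolution[OF k, of u]]
    by (auto simp: C_space_def conv_def)
  moreover have "conv T k (\<lambda>t. u t + v t) = (\<lambda>t. conv T k u t + conv T k v t)"
    if "u \<in> C_space T" "v \<in> C_space T" for u v
    using that
    by (auto simp: fun_eq_iff conv_def matrix_vector_right_distrib integral_add integrable)
  moreover have "conv T k (\<lambda>t. a *s u t) = (\<lambda>t. a *s conv T k u t)" if "u \<in> C_space T" for a u
    using that integral_linear[OF integrable bounded_linear_matrix_vector_mult[of "mat a"]]
    by (auto simp: fun_eq_iff conv_def o_def mat_mult_vector vector_scalar_commute)
  moreover have "\<exists>K\<ge>0. \<forall>u\<in>C_space T. \<forall>t\<in>{0..T}.
      norm (conv T k u t - 0 *v u t) \<le> K * integral {0..t} (\<lambda>s. norm (u s))"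
    using bound b(1) c(1) by (intro exI[of _ "b * c"]) auto
  ultimately show ?thesis
    by (simp add: volterra_split_def)
qed

section \<open>Continuity of the matrix exponential in time\<close>

text \<open>The norm of the matrix type enters only through boundedness of the product, hence the
  constant \<open>c\<close> and the factor \<open>norm (mat 1)\<close>.\<close>

lemma norm_matpow_le:
  fixes A :: "real^'n^'n"
  assumes c: "c > 0" "\<And>(B :: real^'n^'n) (C :: real^'n^'n). norm (B ** C) \<le> norm B * norm C * c"
  shows "norm (matpow A k) \<le> norm (mat 1 :: real^'n^'n) * (norm A * c) ^ k"
proof (induction k)
  case (Suc k)
  have "norm (A ** matpow A k) \<le> norm A * norm (matpow A k) * c"
    by (rule c(2))
  also have "\<dots> \<le> norm A * (norm (mat 1 :: real^'n^'n) * (norm A * c) ^ k) * c"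
    using Suc c by (intro mult_right_mono mult_left_mono) auto
  finally show ?case
    by (simp add: mult_ac)
qed simp

text \<open>Separates \<open>t\<close> from the matrix, so that the exponential becomes a power
  series in \<open>t\<close> with constant matrix coefficients.\<close>

lemma matpow_scaleR: "matpow (t *\<^sub>R A) k = t ^ k *\<^sub>R matpow (A :: real^'n^'n) k"
proof (induction k)
  case (Suc k)
  then show ?case
    by (simp add: bounded_bilinear.scaleR_left[OF bounded_bilinear_matrix_mult]
        bounded_bilinear.scaleR_right[OF bounded_bilinear_matrix_mult])
qed simp

lemma continuous_on_matexp:
  fixes A :: "real^'n^'n"
  shows "continuous_on {0..b} (\<lambda>t. matexp ((- t) *\<^sub>R A))"
proof -
  obtain c where c: "c > 0" "\<And>(B :: real^'n^'n) (C :: real^'n^'n). norm (B ** C) \<le> norm B * norm C * c"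
    using bounded_bilinear.pos_bounded[OF bounded_bilinear_matrix_mult] by blast
  \<comment> \<open>Up to a constant factor, these are the terms of the series for
    \<open>exp (norm A * c * b)\<close>.\<close>
  let ?M = "\<lambda>k. norm (mat 1 :: real^'n^'n) * ((norm A * c * b) ^ k / fact k)"
  have "uniform_limit {0..b} (\<lambda>n t. \<Sum>k<n. (1 / fact k) *\<^sub>R matpow ((- t) *\<^sub>R A) k)
      (\<lambda>t. matexp ((- t) *\<^sub>R A)) sequentially"
    unfolding matexp_def
  proof (rule Weierstrass_m_test)
    show "summable ?M"
      using summable_exp[of "norm A * c * b"]
      by (intro summable_mult) (simp add: divide_inverse mult.commute)
    fix k t assume t: "t \<in> {0..b}"
    have "norm ((1 / fact k) *\<^sub>R matpow ((- t) *\<^sub>R A) k) = t ^ k * norm (matpow A k) / fact k"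
      using t by (simp add: matpow_scaleR power_abs del: scaleR_minus_left)
    also have "\<dots> \<le> b ^ k * (norm (mat 1 :: real^'n^'n) * (norm A * c) ^ k) / fact k"
      using t norm_matpow_le[OF c, of A k]
      by (intro divide_right_mono mult_mono power_mono) auto
    also have "\<dots> = ?M k"
      by (simp add: power_mult_distrib mult_ac)
    finally show "norm ((1 / fact k) *\<^sub>R matpow ((- t) *\<^sub>R A) k) \<le> ?M k" .
  qed
  then show ?thesis
    by (rule uniform_limit_theorem[rotated])
      (auto simp: matpow_scaleR simp del: scaleR_minus_left intro!: always_eventually continuous_intros)
qed

text \<open>The common shape of the smoothing kernel, with \<open>X\<close> the identity, and of the
  correction kernel, with \<open>X\<close> the prolongation and a coarse exponential; hence the
  rectangular outer factors.\<close>

lemma continuous_on_matexp_sandwich: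
  fixes A :: "real^'n^'n" and X :: "real^'n^'m" and Y :: "real^'k^'n"
  shows "continuous_on {0..T} (\<lambda>t. X ** matexp ((- t) *\<^sub>R A) ** Y)"
  by (intro bounded_bilinear.continuous_on[OF bounded_bilinear_matrix_mult]
      continuous_on_matexp continuous_on_const)

section \<open>The two-grid operator\<close>

lemma complex_matrix_hom:
  fixes A B :: "real^'m^'n" and C :: "real^'k^'m"
  shows complex_matrix_add: "complex_matrix (A + B) = complex_matrix A + complex_matrix B"
    and complex_matrix_diff: "complex_matrix (A - B) = complex_matrix A - complex_matrix B"
    and complex_matrix_mult: "complex_matrix (A ** C) = complex_matrix A ** complex_matrix C"
    and complex_matrix_scaleR: "complex_matrix (w *\<^sub>R A) = w *\<^sub>R complex_matrix A"
  by (simp_all add: vec_eq_iff matrix_matrix_mult_def scaleR_conv_of_real[where 'a = complex])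

lemma complex_matrix_one: "complex_matrix (mat 1) = mat 1"
  by (simp add: vec_eq_iff mat_def)

lemma complex_matrix_matpow: "complex_matrix (matpow A k) = matpow (complex_matrix A) k"
  by (induction k) (simp_all add: complex_matrix_hom complex_matrix_one)

lemma volterra_split_funpow:
  assumes "volterra_split T A L"
  shows "volterra_split T (matpow A k) (L ^^ k)"
proof (induction k)
  case 0
  show ?case using volterra_split_id by (simp add: id_def)
next
  case (Suc k)
  then show ?case using volterra_split_compose[OF assms] by (simp add: o_def)
qed

lemma volterra_split_matrix_op: "volterra_split T (complex_matrix A) (matrix_op A)"
  unfolding matrix_op_def[abs_def] by (rule volterra_split_matrix)

lemma volterra_split_wr_op:
  "volterra_split T (complex_matrix (matrix_inv MB ** NB)) (wr_op T MB NB MA NA)"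
proof -
  have "continuous_on {0..T} (wr_kernel MB NB MA NA)"
    using continuous_on_matexp_sandwich[of T "mat 1"]
    by (simp add: wr_kernel_def[abs_def] matrix_mul_assoc[symmetric])
  from volterra_split_add[OF volterra_split_matrix_op volterra_split_conv[OF this]]
  show ?thesis
    by (simp add: wr_op_def[abs_def])
qed

lemma matrix_mult_zero:
  fixes A :: "'a::semiring_1^'m^'n"
  shows "A ** (0 :: 'a^'k^'m) = 0" and "(0 :: 'a^'n^'k) ** A = 0"
  by (simp_all add: vec_eq_iff matrix_matrix_mult_def)

text \<open>The main term contributes the displayed matrix; every summand of \<open>CR_c\<close>
  contains a convolution, so its matrix part is a product with a factor 0.\<close>

lemma volterra_split_CR_op:
  assumes Kn: "volterra_split T M Kn"
  shows "volterra_split T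
    (complex_matrix (mat 1 - coarse_mat Bh BH p r) **
      (mat 1 + w *\<^sub>R (M ** complex_matrix (mat 1 - (1 + 1 / w\<^sup>2) *\<^sub>R coarse_mat Bh BH p r))))
    (CR_op T w Bh Ah BH AH p r Kn)"
proof -
  let ?S = "mat 1 + w *\<^sub>R (M ** complex_matrix (mat 1 - (1 + 1 / w\<^sup>2) *\<^sub>R coarse_mat Bh BH p r))"
  let ?P = "matrix_op (mat 1 - coarse_mat Bh BH p r)"
  have "continuous_on {0..T} (C2c Bh Ah BH AH p r)"
    unfolding C2c_def[abs_def]
    using continuous_on_matexp_sandwich by (simp add: matrix_mul_assoc[symmetric])
  then have C2: "volterra_split T 0 (conv T (C2c Bh Ah BH AH p r))"
    and C1: "volterra_split T 0 (conv T (C1c w Bh Ah BH AH p r))"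
    unfolding C1c_def[abs_def] by (auto intro!: volterra_split_conv continuous_intros)
  have inner: "volterra_split T ?S (CR_inner w Bh BH p r Kn)"
    unfolding CR_inner_def[abs_def]
    by (intro volterra_split_add volterra_split_id volterra_split_scaleR
        volterra_split_compose[OF Kn] volterra_split_matrix_op)
  have KC: "volterra_split T (M ** 0) (\<lambda>u. Kn (conv T (C1c w Bh Ah BH AH p r) u))"
    by (rule volterra_split_compose[OF Kn C1])
  have "volterra_split T
      (0 ** ?S + w *\<^sub>R (complex_matrix (mat 1 - coarse_mat Bh BH p r) ** (M ** 0)) + w *\<^sub>R (0 ** (M ** 0)))
      (CR_c T w Bh Ah BH AH p r Kn)"
    unfolding CR_c_def[abs_def]
    by (intro volterra_split_add volterra_split_scaleR volterra_split_compose[OF C2 inner]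
        volterra_split_compose[OF C2 KC] volterra_split_compose[OF volterra_split_matrix_op KC])
  then have "volterra_split T 0 (CR_c T w Bh Ah BH AH p r Kn)"
    by (simp only: matrix_mult_zero add_0 scaleR_zero_right)
  from volterra_split_add[OF volterra_split_compose[OF volterra_split_matrix_op inner] this]
  show ?thesis
    by (simp add: CR_op_def[abs_def])
qed

theorem lemma2p6:
  fixes \<Omega> :: "(real^2) set"
    and \<T>h \<T>H :: "(real^2) set set"
    and \<xi> :: "'n::finite \<Rightarrow> real^2" and \<phi> :: "'n \<Rightarrow> real^2 \<Rightarrow> real"
    and \<Xi> :: "'m::finite \<Rightarrow> real^2" and \<Phi> :: "'m \<Rightarrow> real^2 \<Rightarrow> real"
    and Bh Ah MB NB MA NA :: "real^'n^'n"
    and BH AH :: "real^'m^'m"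
    and p :: "real^'m^'n" and r :: "real^'n^'m"
    and c T w :: real and \<nu>\<^sub>1 \<nu>\<^sub>2 \<nu>\<^sub>3 :: nat
  assumes domain: "open \<Omega>" "connected \<Omega>" "bounded \<Omega>" "\<Omega> \<noteq> {}"
    and fine: "admissible_mesh \<Omega> \<T>h" "nodal_basis \<Omega> \<T>h \<xi> \<phi>"
    and coarse: "admissible_mesh \<Omega> \<T>H" "nodal_basis \<Omega> \<T>H \<Xi> \<Phi>"
    and nested: "mesh_vertices \<T>H \<subseteq> mesh_vertices \<T>h" "mesh_size \<T>H = 2 * mesh_size \<T>h"
    and fine_matrices: "Bh = mass_matrix \<Omega> \<phi>" "Ah = stiffness_matrix \<Omega> \<phi>"
    and coarse_matrices: "BH = mass_matrix \<Omega> \<Phi>" "AH = stiffness_matrix \<Omega> \<Phi>"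
    and transfer: "p = prolongation \<xi> \<Phi>" "c > 0" "r = c *\<^sub>R transpose p"
    and splittings: "Bh = MB - NB" "Ah = MA - NA" "invertible MB"
    and params: "T > 0" "w \<noteq> 0"
  shows "bounded_operator T
           (two_grid_op T w Bh Ah BH AH p r (wr_op T MB NB MA NA) \<nu>\<^sub>1 \<nu>\<^sub>2 \<nu>\<^sub>3) \<and>
         op_spectral_radius T
           (two_grid_op T w Bh Ah BH AH p r (wr_op T MB NB MA NA) \<nu>\<^sub>1 \<nu>\<^sub>2 \<nu>\<^sub>3) =
         matrix_spectral_radius (complex_matrix
           (matpow (matrix_inv MB ** NB) \<nu>\<^sub>3 **
            (mat 1 - p ** matrix_inv BH ** r ** Bh) **
            (mat 1 + w *\<^sub>R (matpow (matrix_inv MB ** NB) \<nu>\<^sub>2 **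
               (mat 1 - (1 + 1 / w\<^sup>2) *\<^sub>R (p ** matrix_inv BH ** r ** Bh)))) **
            matpow (matrix_inv MB ** NB) \<nu>\<^sub>1))"
proof -
  let ?J = "matrix_inv MB ** NB" and ?K = "wr_op T MB NB MA NA"
  let ?N = "two_grid_op T w Bh Ah BH AH p r ?K \<nu>\<^sub>1 \<nu>\<^sub>2 \<nu>\<^sub>3"
  have pow: "volterra_split T (complex_matrix (matpow ?J k)) (?K ^^ k)" for k
    using volterra_split_funpow[OF volterra_split_wr_op] by (simp add: complex_matrix_matpow)
  let ?A = "complex_matrix
           (matpow ?J \<nu>\<^sub>3 **
            (mat 1 - p ** matrix_inv BH ** r ** Bh) **
            (mat 1 + w *\<^sub>R (matpow ?J \<nu>\<^sub>2 **
               (mat 1 - (1 + 1 / w\<^sup>2) *\<^sub>R (p ** matrix_inv BH ** r ** Bh)))) **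
            matpow ?J \<nu>\<^sub>1)"
  \<comment> \<open>Composition yields a product of complex matrices; compatibility of
    \<open>complex_matrix\<close> with the matrix operations identifies it with the complexified
    real product \<open>?A\<close>.\<close>
  have split: "volterra_split T ?A ?N"
    using volterra_split_compose[OF pow[of \<nu>\<^sub>3] volterra_split_compose[OF
          volterra_split_CR_op[OF pow[of \<nu>\<^sub>2], of Bh BH p r w Ah AH] pow[of \<nu>\<^sub>1]]]
    by (simp add: two_grid_op_def[abs_def] coarse_mat_def complex_matrix_hom complex_matrix_one
        matrix_mul_assoc)
  \<comment> \<open>Both spectral radii are suprema of the norm over the same set.\<close>
  show ?thesis
    using volterra_split_bounded_operator[OF split] op_spectrum_volterra_split[OF split] \<open>T > 0\<close>
    by (simp add: op_spectral_radius_def matrix_spectral_radius_def)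
qed

end
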